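(* Let $\mathfrak q$ be a finite-dimensional Lie algebra over a field $\Bbbk$ of characteristic zero, let $D\in\mathfrak{gl}(\mathfrak q)$, and let $\widehat D:\mathcal S(\mathfrak q)\to\mathcal S(\mathfrak q)$ be the extension of $D$ by the Leibniz rule, i.e. the derivation of $(\mathcal S(\mathfrak q),\cdot)$ with $\widehat D|_{\mathfrak q}=D$. Then (1) $[\ ,\,]'_D$ is a Lie bracket on $\mathfrak q$ if and only if $\{\ ,\,\}'_{\widehat D}$ is a Poisson bracket on $\mathcal S(\mathfrak q)$; (2) $D$ is a near-derivation (respectively, quasi-derivation) of $(\mathfrak q,[\ ,\,])$ if and only if $\widehat D$ is a near-derivation (respectively, quasi-derivation) of $(\mathcal S(\mathfrak q),\{\ ,\,\})$; (3) if $D$ is a near-derivation of $(\mathfrak q,[\ ,\,])$, then the Lie brackets $[\ ,\,]$ and $[\ ,\,]'_D$ are compatible.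
   Context: $\mathcal S(\mathfrak q)$ is the symmetric algebra of $\mathfrak q$ with its usual commutative multiplication $\cdot$ and its Poisson bracket $\{\ ,\,\}$, the unique bracket extending the Lie bracket of $\mathfrak q$ and satisfying the Leibniz rule. A Poisson bracket on $\mathcal S(\mathfrak q)$ is a skew-symmetric bilinear operation satisfying the Jacobi identity and the Leibniz rule with respect to $\cdot$. For a vector space $\mathcal A$ with bilinear operation $\psi$ and a linear map $D:\mathcal A\to\mathcal A$, the derived operation is $\psi'_D(x,y)=D(\psi(x,y))-\psi(Dx,y)-\psi(x,Dy)$, and $\psi''_D=(\psi'_D)'_D$. A quasi-derivation of $(\mathcal A,\psi)$ is a linear map $D$ with $\psi''_D=0$; a near-derivation is a linear map $D$ with $\psi''_D\in\langle\psi,\psi'_D\rangle$ (linear span). In particular $[x,y]'_D=D([x,y])-[Dx,y]-[x,Dy]$. Two Lie brackets on the same vector space are compatible if all their linear combinations are Lie brackets (equivalently, if their sum is a Lie bracket). *)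

theory Defs
  imports Complex_Main "HOL-Library.Poly_Mapping"
begin

text \<open>
  A vector space over a field \<open>'k\<close> is a type \<open>'a :: ab_group_add\<close> with a scalar
  multiplication \<open>s\<close> satisfying \<^locale>\<open>vector_space\<close>; operations are binary functions on \<open>'a\<close>.
\<close>

definition bilinear_op :: "('k::field \<Rightarrow> 'a::ab_group_add \<Rightarrow> 'a) \<Rightarrow> ('a \<Rightarrow> 'a \<Rightarrow> 'a) \<Rightarrow> bool" where
  "bilinear_op s \<psi> \<longleftrightarrow>
     (\<forall>x. Vector_Spaces.linear s s (\<lambda>y. \<psi> x y)) \<and> (\<forall>y. Vector_Spaces.linear s s (\<lambda>x. \<psi> x y))"

text \<open>
  Used in characteristic zero only, where skew-symmetry amounts to \<open>\<psi> x x = 0\<close>.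
\<close>

definition lie_bracket :: "('k::field \<Rightarrow> 'a::ab_group_add \<Rightarrow> 'a) \<Rightarrow> ('a \<Rightarrow> 'a \<Rightarrow> 'a) \<Rightarrow> bool" where
  "lie_bracket s \<psi> \<longleftrightarrow> bilinear_op s \<psi> \<and>
     (\<forall>x y. \<psi> x y = - \<psi> y x) \<and>
     (\<forall>x y z. \<psi> x (\<psi> y z) + \<psi> y (\<psi> z x) + \<psi> z (\<psi> x y) = 0)"

definition compatible_lie_brackets ::
  "('k::field \<Rightarrow> 'a::ab_group_add \<Rightarrow> 'a) \<Rightarrow> ('a \<Rightarrow> 'a \<Rightarrow> 'a) \<Rightarrow> ('a \<Rightarrow> 'a \<Rightarrow> 'a) \<Rightarrow> bool" where
  "compatible_lie_brackets s \<psi> \<phi> \<longleftrightarrow> lie_bracket s \<psi> \<and> lie_bracket s \<phi> \<and>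
     (\<forall>a b. lie_bracket s (\<lambda>x y. s a (\<psi> x y) + s b (\<phi> x y)))"

definition derived_op :: "('a::ab_group_add \<Rightarrow> 'a) \<Rightarrow> ('a \<Rightarrow> 'a \<Rightarrow> 'a) \<Rightarrow> 'a \<Rightarrow> 'a \<Rightarrow> 'a" where
  "derived_op D \<psi> x y = D (\<psi> x y) - \<psi> (D x) y - \<psi> x (D y)"

definition quasi_derivation ::
  "('k::field \<Rightarrow> 'a::ab_group_add \<Rightarrow> 'a) \<Rightarrow> ('a \<Rightarrow> 'a \<Rightarrow> 'a) \<Rightarrow> ('a \<Rightarrow> 'a) \<Rightarrow> bool" where
  "quasi_derivation s \<psi> D \<longleftrightarrow> Vector_Spaces.linear s s D \<and>
     (\<forall>x y. derived_op D (derived_op D \<psi>) x y = 0)"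

definition near_derivation ::
  "('k::field \<Rightarrow> 'a::ab_group_add \<Rightarrow> 'a) \<Rightarrow> ('a \<Rightarrow> 'a \<Rightarrow> 'a) \<Rightarrow> ('a \<Rightarrow> 'a) \<Rightarrow> bool" where
  "near_derivation s \<psi> D \<longleftrightarrow> Vector_Spaces.linear s s D \<and>
     (\<exists>a b. \<forall>x y. derived_op D (derived_op D \<psi>) x y = s a (\<psi> x y) + s b (derived_op D \<psi> x y))"

definition comm_algebra :: "('k::field \<Rightarrow> 's::comm_ring_1 \<Rightarrow> 's) \<Rightarrow> bool" where
  "comm_algebra s \<longleftrightarrow> vector_space s \<and> (\<forall>c x y. s c (x * y) = s c x * y)"

definition algebra_derivation ::
  "('k::field \<Rightarrow> 's::comm_ring_1 \<Rightarrow> 's) \<Rightarrow> ('s \<Rightarrow> 's) \<Rightarrow> bool" where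
  "algebra_derivation s E \<longleftrightarrow> Vector_Spaces.linear s s E \<and>
     (\<forall>x y. E (x * y) = E x * y + x * E y)"

text \<open>By skew-symmetry, the Leibniz rule in the first argument gives the one in the second.\<close>

definition poisson_bracket ::
  "('k::field \<Rightarrow> 's::comm_ring_1 \<Rightarrow> 's) \<Rightarrow> ('s \<Rightarrow> 's \<Rightarrow> 's) \<Rightarrow> bool" where
  "poisson_bracket s P \<longleftrightarrow> lie_bracket s P \<and>
     (\<forall>x y z. P (x * y) z = x * P y z + P x z * y)"

text \<open>
  \<open>('v \<Rightarrow>\<^sub>0 nat) \<Rightarrow>\<^sub>0 'k\<close> is the polynomial algebra over \<open>'k\<close> with one indeterminate
  for every element of \<open>'v\<close>: the outer finitely supported function assigns coefficients to
  monomials, and the monomials are the finitely supported exponent functions.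
\<close>

definition indet :: "'v \<Rightarrow> ('v \<Rightarrow>\<^sub>0 nat) \<Rightarrow>\<^sub>0 'k::field" where
  "indet v = Poly_Mapping.single (Poly_Mapping.single v 1) 1"

definition const_poly :: "'k::field \<Rightarrow> ('v \<Rightarrow>\<^sub>0 nat) \<Rightarrow>\<^sub>0 'k" where
  "const_poly c = Poly_Mapping.single 0 c"

definition linear_relations ::
  "('k::field \<Rightarrow> 'v::ab_group_add \<Rightarrow> 'v) \<Rightarrow> (('v \<Rightarrow>\<^sub>0 nat) \<Rightarrow>\<^sub>0 'k) set" where
  "linear_relations s =
     {indet (u + v) - indet u - indet v | u v. True} \<union>
     {indet (s c v) - const_poly c * indet v | c v. True}"

text \<open>
  The symmetric algebra of a vector space \<open>V\<close> is the quotient of the polynomial algebra on the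
  set \<open>V\<close> by the ideal generated by the linear relations of \<open>V\<close>.
  HOL types cannot depend on the scalar multiplication of \<open>V\<close>, so instead of a quotient type we
  say when a commutative algebra \<open>S\<close> together with a map \<open>\<iota>\<close> from \<open>V\<close> to \<open>S\<close> is (isomorphic to)
  that quotient, with \<open>\<iota> v\<close> the class of \<open>indet v\<close>; here \<open>\<pi>\<close> is the quotient map.
  The span over the polynomial ring, viewed as a module over itself, is the generated ideal.
\<close>

definition symmetric_algebra ::
  "('k::field \<Rightarrow> 'v::ab_group_add \<Rightarrow> 'v) \<Rightarrow> ('k \<Rightarrow> 's::comm_ring_1 \<Rightarrow> 's) \<Rightarrow> ('v \<Rightarrow> 's) \<Rightarrow> bool" where
  "symmetric_algebra sV sS \<iota> \<longleftrightarrow> comm_algebra sS \<and>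
     (\<exists>\<pi> :: (('v \<Rightarrow>\<^sub>0 nat) \<Rightarrow>\<^sub>0 'k) \<Rightarrow> 's.
        (\<forall>f g. \<pi> (f + g) = \<pi> f + \<pi> g) \<and>
        (\<forall>f g. \<pi> (f * g) = \<pi> f * \<pi> g) \<and>
        (\<forall>c. \<pi> (const_poly c) = sS c 1) \<and>
        (\<forall>v. \<pi> (indet v) = \<iota> v) \<and>
        surj \<pi> \<and>
        {f. \<pi> f = 0} = module.span (*) (linear_relations sV))"

text \<open>
  The two definite descriptions below are meant for a symmetric algebra \<open>\<iota>\<close>, a Lie bracket \<open>br\<close>
  and a linear map \<open>D\<close>; the objects described then exist uniquely, since the image of \<open>\<iota>\<close>
  generates the algebra and a linear map on it extends to a derivation.
\<close>

definition lie_poisson ::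
  "('k::field \<Rightarrow> 's::comm_ring_1 \<Rightarrow> 's) \<Rightarrow> ('v \<Rightarrow> 's) \<Rightarrow> ('v \<Rightarrow> 'v \<Rightarrow> 'v) \<Rightarrow> 's \<Rightarrow> 's \<Rightarrow> 's" where
  "lie_poisson s \<iota> br =
     (THE P. poisson_bracket s P \<and> (\<forall>x y. P (\<iota> x) (\<iota> y) = \<iota> (br x y)))"

definition leibniz_extension ::
  "('k::field \<Rightarrow> 's::comm_ring_1 \<Rightarrow> 's) \<Rightarrow> ('v \<Rightarrow> 's) \<Rightarrow> ('v \<Rightarrow> 'v) \<Rightarrow> 's \<Rightarrow> 's" where
  "leibniz_extension s \<iota> D =
     (THE E. algebra_derivation s E \<and> (\<forall>x. E (\<iota> x) = \<iota> (D x)))"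

end

theory Submission
  imports Defs
begin

text \<open>
  A derivation of the symmetric algebra is determined by its values on the generators
  \<open>\<iota> v\<close>, and these values may be any linear function of \<open>v\<close>. All claims except
  compatibility are this principle applied in each variable separately.

  Let \<open>P\<close> be the Lie-Poisson bracket and \<open>E\<close> the derivation extending \<open>D\<close>. Since \<open>E\<close> is a
  derivation of the commutative product and \<open>P\<close> is a derivation in each argument, the derived
  operation \<open>P'\<close> is again a derivation in each argument (\<open>biderivation_derived_op\<close>), and on
  generators it is the derived bracket of the Lie algebra. The same then holds for \<open>P''\<close> and for
  every combination of \<open>P\<close> and \<open>P'\<close>. Two biderivations agreeing on generators are equal, so a
  relation \<open>P'' = a P + b P'\<close> holds as soon as it holds on generators; as \<open>\<iota>\<close> is injective
  (\<open>symmetric_algebra_inj\<close>), it holds there exactly when it holds in the Lie algebra. This is the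
  near-derivation claim, and \<open>a = b = 0\<close> is the quasi-derivation claim. Likewise the Jacobiator of
  a skew-symmetric biderivation is a derivation in each of its three arguments
  (\<open>algebra_derivation_jacobiator\<close>), so the Jacobi identity for \<open>P'\<close> may be tested on generators;
  this is the claim on Lie and Poisson brackets.

  Compatibility comes from differentiating the Jacobi identity. Write \<open>J(\<psi>, \<phi>)\<close> for the cyclic sum
  of \<open>\<psi>(x, \<phi>(y, z))\<close>. The action of \<open>D\<close> on operations satisfies the product rule
  \<open>J(\<psi>, \<phi>)' = J(\<psi>', \<phi>) + J(\<psi>, \<phi>')\<close>. Applied to \<open>J(\<psi>, \<psi>) = 0\<close> it gives
  \<open>J(\<psi>', \<psi>) + J(\<psi>, \<psi>') = 0\<close>, and applied again
  \<open>J(\<psi>'', \<psi>) + 2 J(\<psi>', \<psi>') + J(\<psi>, \<psi>'') = 0\<close>. When \<open>\<psi>'' = a \<psi> + b \<psi>'\<close> the outer terms add up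
  to \<open>0\<close> by the first two identities, whence \<open>J(\<psi>', \<psi>') = 0\<close> because \<open>2\<close> is invertible.

  Existence of these objects rests on \<open>derivation_extension_exists\<close>, which is obtained by
  differentiating polynomials and checking that the linear relations are respected.
\<close>

section \<open>Derivations of a polynomial algebra along a ring homomorphism\<close>

lemma poly_mapping_add_induct [case_names zero single add]:
  fixes f :: "'a \<Rightarrow>\<^sub>0 'b::comm_monoid_add"
  assumes zero: "P 0"
    and single: "\<And>k c. P (Poly_Mapping.single k c)"
    and add: "\<And>f g. P f \<Longrightarrow> P g \<Longrightarrow> P (f + g)"
  shows "P f"
proof (induction f rule: update_induct)
  case const
  then show ?case by (rule zero)
next
  case (update f a b)
  have "Poly_Mapping.update a b f = f + Poly_Mapping.single a b"
    using update(1)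
    by (intro poly_mapping_eqI) (auto simp: lookup_update lookup_add lookup_single in_keys_iff)
  then show ?case using add[OF update(3) single] by simp
qed

lemma single_eq_const_poly_mult:
  "Poly_Mapping.single m c = const_poly c * Poly_Mapping.single m (1::'k::field)"
  by (simp add: const_poly_def mult_single)

lemma polynomial_induct [case_names const indet add mult]:
  fixes f :: "('v \<Rightarrow>\<^sub>0 nat) \<Rightarrow>\<^sub>0 'k::field"
  assumes const: "\<And>c. P (const_poly c)"
    and indet: "\<And>v. P (indet v)"
    and add: "\<And>f g. P f \<Longrightarrow> P g \<Longrightarrow> P (f + g)"
    and mult: "\<And>f g. P f \<Longrightarrow> P g \<Longrightarrow> P (f * g)"
  shows "P f"
proof -
  have one: "P 1" using const[of 1] by (simp add: const_poly_def)
  have power_case: "P (Poly_Mapping.single (Poly_Mapping.single v n) 1)" for v n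
  proof (induction n)
    case 0
    then show ?case using one by simp
  next
    case (Suc n)
    have "Poly_Mapping.single (Poly_Mapping.single v (Suc n)) (1::'k)
        = indet v * Poly_Mapping.single (Poly_Mapping.single v n) 1"
      by (simp add: indet_def mult_single flip: single_add)
    then show ?case using mult[OF indet Suc] by simp
  qed
  have monomial_case: "P (Poly_Mapping.single m 1)" for m :: "'v \<Rightarrow>\<^sub>0 nat"
  proof (induction m rule: poly_mapping_add_induct)
    case zero
    then show ?case using one by simp
  next
    case (single k c)
    then show ?case by (rule power_case)
  next
    case (add m n)
    then show ?case using mult[OF add] by (simp add: mult_single)
  qed
  show ?thesis
  proof (induction f rule: poly_mapping_add_induct)
    case zero
    then show ?case using const[of 0] by (simp add: const_poly_def)
  next
    case (single m c)
    then show ?case using mult[OF const monomial_case] by (subst single_eq_const_poly_mult)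
  next
    case (add f g)
    then show ?case by (rule assms(3))
  qed
qed

locale polynomial_hom =
  fixes \<pi> :: "(('v \<Rightarrow>\<^sub>0 nat) \<Rightarrow>\<^sub>0 'k::field) \<Rightarrow> 'r::comm_ring_1"
  assumes hom_add: "\<pi> (f + g) = \<pi> f + \<pi> g"
    and hom_mult: "\<pi> (f * g) = \<pi> f * \<pi> g"
    and hom_one: "\<pi> 1 = 1"
begin

lemma hom_zero: "\<pi> 0 = 0"
  using hom_add[of 0 0] by simp

lemma hom_const_poly_add: "\<pi> (const_poly (c + d)) = \<pi> (const_poly c) + \<pi> (const_poly d)"
  by (simp add: const_poly_def single_add hom_add)

lemma hom_const_poly_mult: "\<pi> (const_poly (c * d)) = \<pi> (const_poly c) * \<pi> (const_poly d)"
  by (simp add: const_poly_def mult_single flip: hom_mult)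

lemma hom_const_poly_zero: "\<pi> (const_poly 0) = 0"
  by (simp add: const_poly_def hom_zero)

lemma hom_const_poly_one: "\<pi> (const_poly 1) = 1"
  by (simp add: const_poly_def hom_one)

lemma hom_single: "\<pi> (Poly_Mapping.single m c) = \<pi> (const_poly c) * \<pi> (Poly_Mapping.single m 1)"
  by (metis single_eq_const_poly_mult hom_mult)

text \<open>
  Together, the next two functions form the total differential \<open>f \<mapsto> \<Sum>v. (\<partial>f/\<partial>v) * a v\<close>, with the partial
  derivatives evaluated through \<open>\<pi>\<close>. Taking values in the target of \<open>\<pi>\<close>, and not in polynomials,
  lets the same construction serve the quotient map of the symmetric algebra and the evaluation of
  polynomials at the origin.
\<close>

definition monomial_derivation :: "('v \<Rightarrow> 'r) \<Rightarrow> ('v \<Rightarrow>\<^sub>0 nat) \<Rightarrow> 'r" where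
  "monomial_derivation a m =
     (\<Sum>v\<in>Poly_Mapping.keys m. of_nat (poly_mapping.lookup m v)
        * \<pi> (Poly_Mapping.single (m - Poly_Mapping.single v 1) 1) * a v)"

definition polynomial_derivation :: "('v \<Rightarrow> 'r) \<Rightarrow> (('v \<Rightarrow>\<^sub>0 nat) \<Rightarrow>\<^sub>0 'k) \<Rightarrow> 'r" where
  "polynomial_derivation a f =
     (\<Sum>m\<in>Poly_Mapping.keys f. \<pi> (const_poly (poly_mapping.lookup f m)) * monomial_derivation a m)"

lemma monomial_derivation_superset:
  assumes "finite A" "Poly_Mapping.keys m \<subseteq> A"
  shows "monomial_derivation a m = (\<Sum>v\<in>A. of_nat (poly_mapping.lookup m v)
        * \<pi> (Poly_Mapping.single (m - Poly_Mapping.single v 1) 1) * a v)"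
  unfolding monomial_derivation_def using assms
  by (intro sum.mono_neutral_left) (auto simp: in_keys_iff)

lemma monomial_derivation_add:
  "monomial_derivation a (m + n)
     = monomial_derivation a m * \<pi> (Poly_Mapping.single n 1)
       + \<pi> (Poly_Mapping.single m 1) * monomial_derivation a n"
proof -
  let ?A = "Poly_Mapping.keys m \<union> Poly_Mapping.keys n"
  let ?X = "\<lambda>m. \<pi> (Poly_Mapping.single m 1)"
  let ?e = "\<lambda>v. Poly_Mapping.single v (1::nat)"
  have *: "of_nat (poly_mapping.lookup m v) * ?X (m + n - ?e v)
      = of_nat (poly_mapping.lookup m v) * ?X (m - ?e v) * ?X n" for m n v
  proof (cases "poly_mapping.lookup m v = 0")
    case False
    \<comment> \<open>Subtraction of exponents is truncated, so it commutes with the sum only where \<open>v\<close>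
      occurs in \<open>m\<close>; elsewhere the coefficient vanishes.\<close>
    then have "m + n - ?e v = (m - ?e v) + n"
      by (intro poly_mapping_eqI) (auto simp: lookup_add lookup_minus lookup_single when_def)
    then show ?thesis by (simp add: mult_single mult.assoc flip: hom_mult)
  qed simp
  have "monomial_derivation a (m + n) = (\<Sum>v\<in>?A. of_nat (poly_mapping.lookup (m + n) v)
        * ?X (m + n - ?e v) * a v)"
    using keys_add[of m n] by (intro monomial_derivation_superset) auto
  also have "\<dots> = (\<Sum>v\<in>?A. of_nat (poly_mapping.lookup m v) * ?X (m + n - ?e v) * a v
      + of_nat (poly_mapping.lookup n v) * ?X (n + m - ?e v) * a v)"
    by (intro sum.cong) (simp_all add: lookup_add algebra_simps)
  also have "\<dots> = (\<Sum>v\<in>?A. (of_nat (poly_mapping.lookup m v) * ?X (m - ?e v) * a v) * ?X n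
      + ?X m * (of_nat (poly_mapping.lookup n v) * ?X (n - ?e v) * a v))"
    unfolding * by (intro sum.cong) (simp_all add: mult_ac)
  also have "\<dots> = monomial_derivation a m * ?X n + ?X m * monomial_derivation a n"
    by (subst (1 2) monomial_derivation_superset[of ?A])
      (auto simp: sum.distrib sum_distrib_left sum_distrib_right)
  finally show ?thesis .
qed

lemma polynomial_derivation_superset:
  assumes "finite A" "Poly_Mapping.keys f \<subseteq> A"
  shows "polynomial_derivation a f
    = (\<Sum>m\<in>A. \<pi> (const_poly (poly_mapping.lookup f m)) * monomial_derivation a m)"
  unfolding polynomial_derivation_def using assms
  by (intro sum.mono_neutral_left) (auto simp: in_keys_iff hom_const_poly_zero)

lemma polynomial_derivation_add:
  "polynomial_derivation a (f + g) = polynomial_derivation a f + polynomial_derivation a g"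
proof -
  let ?A = "Poly_Mapping.keys f \<union> Poly_Mapping.keys g"
  show ?thesis
    using keys_add[of f g]
    by (subst (1 2 3) polynomial_derivation_superset[of ?A])
      (auto simp: lookup_add hom_const_poly_add algebra_simps sum.distrib)
qed

lemma polynomial_derivation_single:
  "polynomial_derivation a (Poly_Mapping.single m c) = \<pi> (const_poly c) * monomial_derivation a m"
  by (subst polynomial_derivation_superset[of "{m}"]) auto

lemma polynomial_derivation_mult:
  "polynomial_derivation a (f * g) = polynomial_derivation a f * \<pi> g + \<pi> f * polynomial_derivation a g"
proof (induction f rule: poly_mapping_add_induct)
  case zero
  then show ?case using polynomial_derivation_add[of a 0 0] by (simp add: hom_zero)
next
  case (single m c)
  show ?case
  proof (induction g rule: poly_mapping_add_induct)
    case zero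
    then show ?case using polynomial_derivation_add[of a 0 0] by (simp add: hom_zero)
  next
    case (single n d)
    then show ?case
      by (simp add: mult_single polynomial_derivation_single monomial_derivation_add
          hom_const_poly_mult hom_single[of m c] hom_single[of n d] algebra_simps)
  next
    case (add f g)
    then show ?case by (simp add: distrib_left polynomial_derivation_add hom_add algebra_simps)
  qed
next
  case (add f g)
  then show ?case by (simp add: distrib_right polynomial_derivation_add hom_add algebra_simps)
qed

lemma polynomial_derivation_const: "polynomial_derivation a (const_poly c) = 0"
  by (simp add: const_poly_def polynomial_derivation_single monomial_derivation_def)

lemma polynomial_derivation_indet: "polynomial_derivation a (indet v) = a v"
  by (simp add: indet_def polynomial_derivation_single monomial_derivation_def hom_one
      hom_const_poly_one)

lemma polynomial_derivation_diff:
  "polynomial_derivation a (f - g) = polynomial_derivation a f - polynomial_derivation a g"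
  using polynomial_derivation_add[of a "f - g" g] by simp

lemma hom_diff: "\<pi> (f - g) = \<pi> f - \<pi> g"
  using hom_add[of "f - g" g] by simp

end

text \<open>
  Along \<open>\<pi>\<close>, a product \<open>f * r\<close> with \<open>\<pi> r = 0\<close> is sent to \<open>\<pi> f\<close> times the image of \<open>r\<close>; so it is
  enough that the linear relations themselves are killed, and on these the derivation sees only
  the linear map \<open>a\<close>.
\<close>

lemma polynomial_derivation_kills_relations:
  fixes s :: "'k::field \<Rightarrow> 'v::ab_group_add \<Rightarrow> 'v"
    and \<pi> :: "(('v \<Rightarrow>\<^sub>0 nat) \<Rightarrow>\<^sub>0 'k) \<Rightarrow> 'r::comm_ring_1"
  assumes hom: "polynomial_hom \<pi>"
    and hom_lin: "\<And>u v. \<pi> (indet (u + v)) = \<pi> (indet u) + \<pi> (indet v)"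
      "\<And>c v. \<pi> (indet (s c v)) = \<pi> (const_poly c) * \<pi> (indet v)"
    and lin: "\<And>u v. a (u + v) = a u + a v" "\<And>c v. a (s c v) = \<pi> (const_poly c) * a v"
    and f: "f \<in> module.span (*) (linear_relations s)"
  shows "polynomial_hom.polynomial_derivation \<pi> a f = 0"
proof -
  interpret polynomial_hom \<pi> by fact
  have rel: "\<pi> r = 0 \<and> polynomial_derivation a r = 0" if "r \<in> linear_relations s" for r
    using that unfolding linear_relations_def
    by (auto simp: hom_diff hom_mult hom_lin polynomial_derivation_diff polynomial_derivation_mult
        polynomial_derivation_const polynomial_derivation_indet lin)
  interpret module "(*) :: (('v \<Rightarrow>\<^sub>0 nat) \<Rightarrow>\<^sub>0 'k) \<Rightarrow> _"
    by unfold_locales (simp_all add: algebra_simps)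
  show ?thesis
    using f
  proof (induction rule: span_induct_alt)
    case base
    then show ?case using polynomial_derivation_add[of a 0 0] by simp
  next
    case (step c x y)
    then show ?case using rel[OF step(1)]
      by (simp add: polynomial_derivation_add polynomial_derivation_mult)
  qed
qed

section \<open>The symmetric algebra\<close>

lemma linearI:
  assumes "vector_space s" "vector_space t"
    "\<And>x y. f (x + y) = f x + f y" "\<And>c x. f (s c x) = t c (f x)"
  shows "Vector_Spaces.linear s t f"
  using assms by (simp add: Vector_Spaces.linear_iff)

lemma linearD:
  assumes "Vector_Spaces.linear s t f"
  shows "vector_space s" "vector_space t" "f (x + y) = f x + f y" "f (s c x) = t c (f x)"
    "f (x - y) = f x - f y" "f (- x) = - f x" "f 0 = 0"
proof -
  show "vector_space s" "vector_space t" and add: "f (x + y) = f x + f y" "f (s c x) = t c (f x)"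
    for x y c
    using assms by (simp_all add: Vector_Spaces.linear_iff)
  show zero: "f 0 = 0" using add(1)[of 0 0] by simp
  show "f (x - y) = f x - f y" using add(1)[of "x - y" y] by simp
  show "f (- x) = - f x" using add(1)[of "- x" x] zero by (simp add: eq_neg_iff_add_eq_0)
qed

lemma comm_algebraD:
  assumes "comm_algebra s"
  shows "vector_space s" "s c x * y = s c (x * y)" "x * s c y = s c (x * y)"
proof -
  show "vector_space s" and mult: "s c x * y = s c (x * y)" for c x y
    using assms by (simp_all add: comm_algebra_def)
  show "x * s c y = s c (x * y)" using mult[of c y x] by (simp add: mult.commute)
qed

lemma symmetric_algebra_linear:
  fixes sV :: "'k::field \<Rightarrow> 'v::ab_group_add \<Rightarrow> 'v"
  assumes V: "vector_space sV" and S: "symmetric_algebra sV sS \<iota>"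
  shows "Vector_Spaces.linear sV sS \<iota>"
proof -
  from S obtain \<pi> where \<pi>: "\<And>v. \<pi> (indet v) = \<iota> v" "{f. \<pi> f = 0} = module.span (*) (linear_relations sV)"
    "\<And>f g. \<pi> (f + g) = \<pi> f + \<pi> g" "\<And>f g. \<pi> (f * g) = \<pi> f * \<pi> g" "\<And>c. \<pi> (const_poly c) = sS c 1"
    unfolding symmetric_algebra_def by blast
  have A: "comm_algebra sS" using S by (simp add: symmetric_algebra_def)
  have diff: "\<pi> (f - g) = \<pi> f - \<pi> g" for f g
    using \<pi>(3)[of "f - g" g] by simp
  interpret M: module "(*) :: (('v \<Rightarrow>\<^sub>0 nat) \<Rightarrow>\<^sub>0 'k) \<Rightarrow> _"
    by unfold_locales (simp_all add: algebra_simps)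
  have rel: "\<pi> r = 0" if "r \<in> linear_relations sV" for r
    using \<pi>(2) M.span_base[OF that] by blast
  show ?thesis
  proof (rule linearI)
    show "\<iota> (x + y) = \<iota> x + \<iota> y" for x y
    proof -
      have "\<pi> (indet (x + y) - indet x - indet y) = 0"
        by (rule rel) (auto simp: linear_relations_def)
      then show ?thesis unfolding diff \<pi>(1) by (simp add: algebra_simps)
    qed
    show "\<iota> (sV c x) = sS c (\<iota> x)" for c x
    proof -
      have "\<pi> (indet (sV c x) - const_poly c * indet x) = 0"
        by (rule rel) (auto simp: linear_relations_def)
      then show ?thesis by (simp add: diff \<pi> comm_algebraD(2)[OF A])
    qed
  qed (use V comm_algebraD(1)[OF A] in auto)
qed

text \<open>
  Linear forms separate the points of the vector space, and a linear form extends to a derivation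
  of the polynomial algebra along the augmentation \<open>f \<mapsto> f(0)\<close>; it kills the ideal of
  relations but takes the value of the form at \<open>v\<close> on \<open>indet v\<close>. So \<open>indet v\<close> lies in the ideal only
  if every linear form vanishes at \<open>v\<close>.
\<close>

lemma symmetric_algebra_inj:
  fixes sV :: "'k::field \<Rightarrow> 'v::ab_group_add \<Rightarrow> 'v"
  assumes V: "vector_space sV" and S: "symmetric_algebra sV sS \<iota>"
    and v: "\<iota> v = 0"
  shows "v = 0"
proof -
  interpret V: vector_space sV by fact
  from S obtain \<pi> where \<pi>: "\<And>v. \<pi> (indet v) = \<iota> v" "{f. \<pi> f = 0} = module.span (*) (linear_relations sV)"
    unfolding symmetric_algebra_def by blast
  show "v = 0"
  proof (rule ccontr)
    assume "v \<noteq> 0"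
    interpret pair: vector_space_pair sV "(*) :: 'k \<Rightarrow> 'k \<Rightarrow> 'k"
      by unfold_locales (simp_all add: algebra_simps)
    have "V.independent {v}" using \<open>v \<noteq> 0\<close> by simp
    from pair.linear_independent_extend[OF this, of "\<lambda>_. 1"]
    obtain \<phi> where \<phi>: "Vector_Spaces.linear sV (*) \<phi>" "\<phi> v = 1" by auto
    \<comment> \<open>evaluation at the origin\<close>
    define \<epsilon> where "\<epsilon> f = poly_mapping.lookup f 0" for f :: "('v \<Rightarrow>\<^sub>0 nat) \<Rightarrow>\<^sub>0 'k"
    have plus_0: "m + n = 0 \<longleftrightarrow> m = 0 \<and> n = 0" for m n :: "'v \<Rightarrow>\<^sub>0 nat"
      by (auto simp: poly_mapping_eq_iff fun_eq_iff lookup_add)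
    have \<epsilon>_add: "\<epsilon> (f + g) = \<epsilon> f + \<epsilon> g" for f g
      by (simp add: \<epsilon>_def lookup_add)
    have \<epsilon>_single: "\<epsilon> (Poly_Mapping.single m c) = (if m = 0 then c else 0)" for m c
      by (simp add: \<epsilon>_def lookup_single when_def)
    have \<epsilon>_mult: "\<epsilon> (f * g) = \<epsilon> f * \<epsilon> g" for f g
    proof (induction f rule: poly_mapping_add_induct)
      case (single m c)
      show ?case
      proof (induction g rule: poly_mapping_add_induct)
        case (single n d)
        show ?case by (simp add: mult_single \<epsilon>_single plus_0)
      next
        case (add f g)
        then show ?case by (simp add: distrib_left \<epsilon>_add)
      qed (simp add: \<epsilon>_def)
    next
      case (add f h)
      then show ?case by (simp add: distrib_right \<epsilon>_add)
    qed (simp add: \<epsilon>_def)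
    interpret \<epsilon>: polynomial_hom \<epsilon>
      by (rule polynomial_hom.intro) (simp_all only: \<epsilon>_add \<epsilon>_mult, simp add: \<epsilon>_def)
    have "Poly_Mapping.single w (1::nat) \<noteq> 0" for w :: 'v
      by (metis lookup_single_eq lookup_zero one_neq_zero)
    then have \<epsilon>_indet: "\<epsilon> (indet w) = 0" for w
      by (simp only: indet_def \<epsilon>_single if_False)
    have \<epsilon>_const: "\<epsilon> (const_poly c) = c" for c
      by (simp add: const_poly_def \<epsilon>_single)
    have "indet v \<in> module.span (*) (linear_relations sV)"
      by (simp add: \<pi>(1) v flip: \<pi>(2))
    note kills = polynomial_derivation_kills_relations[OF \<epsilon>.polynomial_hom_axioms _ _ _ _ this]
    have "\<epsilon>.polynomial_derivation \<phi> (indet v) = 0"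
      by (rule kills) (simp_all add: \<epsilon>_indet \<epsilon>_const linearD[OF \<phi>(1)])
    then show False using \<phi>(2) by (simp add: \<epsilon>.polynomial_derivation_indet)
  qed
qed

lemma symmetric_algebra_induct [consumes 1, case_names const gen add mult]:
  assumes S: "symmetric_algebra sV sS \<iota>"
    and const: "\<And>c. P (sS c 1)"
    and gen: "\<And>v. P (\<iota> v)"
    and add: "\<And>x y. P x \<Longrightarrow> P y \<Longrightarrow> P (x + y)"
    and mult: "\<And>x y. P x \<Longrightarrow> P y \<Longrightarrow> P (x * y)"
  shows "P t"
proof -
  from S obtain \<pi> where \<pi>: "\<And>f g. \<pi> (f + g) = \<pi> f + \<pi> g" "\<And>f g. \<pi> (f * g) = \<pi> f * \<pi> g"
    "\<And>c. \<pi> (const_poly c) = sS c 1" "\<And>v. \<pi> (indet v) = \<iota> v" "surj \<pi>"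
    unfolding symmetric_algebra_def by blast
  have "P (\<pi> f)" for f
    by (induction f rule: polynomial_induct) (simp_all add: \<pi> const gen add mult)
  then show ?thesis using \<open>surj \<pi>\<close> by (metis surjD)
qed

lemma algebra_derivation_iff:
  "algebra_derivation s E \<longleftrightarrow> vector_space s \<and> (\<forall>x y. E (x + y) = E x + E y) \<and>
     (\<forall>c x. E (s c x) = s c (E x)) \<and> (\<forall>x y. E (x * y) = E x * y + x * E y)"
  by (auto simp: algebra_derivation_def Vector_Spaces.linear_iff)

lemma algebra_derivationD:
  assumes "algebra_derivation s E"
  shows "E (x + y) = E x + E y" "E (s c x) = s c (E x)" "E (x * y) = E x * y + x * E y"
    "E (x - y) = E x - E y" "E (- x) = - E x" "E 0 = 0" "E 1 = 0"
proof -
  have L: "Vector_Spaces.linear s s E" and M: "\<And>x y. E (x * y) = E x * y + x * E y"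
    using assms by (auto simp: algebra_derivation_def)
  show "E (x + y) = E x + E y" "E (s c x) = s c (E x)" "E (x - y) = E x - E y" "E (- x) = - E x" "E 0 = 0"
    using linearD[OF L] by auto
  show "E (x * y) = E x * y + x * E y" by fact
  show "E 1 = 0" using M[of 1 1] by simp
qed

text \<open>
  The total differential along the quotient map \<open>\<pi>\<close> vanishes on the kernel of \<open>\<pi>\<close>, which is the
  ideal of linear relations, because \<open>a\<close> is linear; hence it factors through \<open>\<pi>\<close>.
\<close>

lemma derivation_extension_exists:
  assumes V: "vector_space sV" and S: "symmetric_algebra sV sS \<iota>"
    and a: "Vector_Spaces.linear sV sS a"
  shows "\<exists>E. algebra_derivation sS E \<and> (\<forall>v. E (\<iota> v) = a v)"
proof -
  from S obtain \<pi> where \<pi>: "\<And>f g. \<pi> (f + g) = \<pi> f + \<pi> g" "\<And>f g. \<pi> (f * g) = \<pi> f * \<pi> g"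
    "\<And>c. \<pi> (const_poly c) = sS c 1" "\<And>v. \<pi> (indet v) = \<iota> v" "surj \<pi>"
    "{f. \<pi> f = 0} = module.span (*) (linear_relations sV)"
    unfolding symmetric_algebra_def by blast
  have A: "comm_algebra sS" using S by (simp add: symmetric_algebra_def)
  interpret sS: vector_space sS using comm_algebraD(1)[OF A] .
  have one: "\<pi> 1 = 1" using \<pi>(3)[of 1] by (simp add: const_poly_def)
  interpret polynomial_hom \<pi> by unfold_locales (simp_all add: \<pi> one)
  let ?d = "polynomial_derivation a"
  note \<iota> = linearD[OF symmetric_algebra_linear[OF V S]]
  have kernel: "?d f = 0" if "\<pi> f = 0" for f
  proof (rule polynomial_derivation_kills_relations)
    show "f \<in> module.span (*) (linear_relations sV)" using that by (simp flip: \<pi>(6))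
  qed (simp_all add: polynomial_hom_axioms \<pi>(3,4) linearD[OF a] \<iota> comm_algebraD(2)[OF A])
  define E where "E t = ?d (inv \<pi> t)" for t
  have E: "E (\<pi> f) = ?d f" for f
  proof -
    have "\<pi> (inv \<pi> (\<pi> f) - f) = 0" by (simp add: hom_diff surj_f_inv_f[OF \<pi>(5)])
    then have "?d (inv \<pi> (\<pi> f) - f) = 0" by (rule kernel)
    then show ?thesis by (simp add: E_def polynomial_derivation_diff)
  qed
  have lift: "\<exists>f. t = \<pi> f" for t using \<pi>(5) by (metis surjD)
  have "E (x + y) = E x + E y" for x y
    using lift[of x] lift[of y] by (auto simp: E polynomial_derivation_add simp flip: hom_add)
  moreover have mult: "E (x * y) = E x * y + x * E y" for x y
  proof -
    obtain f g where "x = \<pi> f" "y = \<pi> g" using lift by blast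
    then show ?thesis by (metis E polynomial_derivation_mult hom_mult)
  qed
  moreover have "E (sS c x) = sS c (E x)" for c x
  proof -
    have "E (sS c 1) = 0" using E[of "const_poly c"] by (simp add: \<pi>(3) polynomial_derivation_const)
    then show ?thesis
      using mult[of "sS c 1" x] by (simp add: comm_algebraD(2)[OF A])
  qed
  moreover have "E (\<iota> v) = a v" for v
    using E[of "indet v"] by (simp add: \<pi>(4) polynomial_derivation_indet)
  ultimately show ?thesis
    unfolding algebra_derivation_iff using comm_algebraD(1)[OF A] by blast
qed

lemma derivation_eqI:
  assumes S: "symmetric_algebra sV sS \<iota>"
    and E: "algebra_derivation sS E" and F: "algebra_derivation sS F"
    and gen: "\<And>v. E (\<iota> v) = F (\<iota> v)"
  shows "E t = F t"
  using S
proof (induction t rule: symmetric_algebra_induct)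
  case (const c)
  interpret vector_space sS using E by (simp add: algebra_derivation_iff)
  show ?case by (simp add: algebra_derivationD[OF E] algebra_derivationD[OF F])
qed (simp_all add: algebra_derivationD[OF E] algebra_derivationD[OF F] gen)

lemma leibniz_extension_derivation:
  assumes V: "vector_space sV" and S: "symmetric_algebra sV sS \<iota>"
    and D: "Vector_Spaces.linear sV sV D"
  shows "algebra_derivation sS (leibniz_extension sS \<iota> D)"
    and "leibniz_extension sS \<iota> D (\<iota> x) = \<iota> (D x)"
proof -
  note \<iota> = linearD[OF symmetric_algebra_linear[OF V S]]
  have "Vector_Spaces.linear sV sS (\<lambda>x. \<iota> (D x))"
    by (rule linearI) (simp_all add: \<iota> linearD[OF D])
  from derivation_extension_exists[OF V S this] obtain E
    where E: "algebra_derivation sS E" "\<And>x. E (\<iota> x) = \<iota> (D x)" by blast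
  have "F = E" if "algebra_derivation sS F \<and> (\<forall>x. F (\<iota> x) = \<iota> (D x))" for F
    by (rule ext, rule derivation_eqI[OF S]) (simp_all add: that E)
  with E have "\<exists>!E. algebra_derivation sS E \<and> (\<forall>x. E (\<iota> x) = \<iota> (D x))" by blast
  from theI'[OF this, folded leibniz_extension_def]
  show "algebra_derivation sS (leibniz_extension sS \<iota> D)"
    and "leibniz_extension sS \<iota> D (\<iota> x) = \<iota> (D x)" by auto
qed

section \<open>Biderivations\<close>

lemma algebra_derivation_sum:
  assumes "algebra_derivation s E" "algebra_derivation s F"
  shows "algebra_derivation s (\<lambda>x. E x + F x)"
proof -
  interpret vector_space s using assms by (simp add: algebra_derivation_iff)
  show ?thesis
    using vector_space_axioms unfolding algebra_derivation_iff
    by (simp add: algebra_derivationD[OF assms(1)] algebra_derivationD[OF assms(2)] algebra_simps)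
qed

lemma algebra_derivation_mult:
  assumes "comm_algebra s" "algebra_derivation s E"
  shows "algebra_derivation s (\<lambda>x. a * E x)"
  unfolding algebra_derivation_iff
  by (simp add: comm_algebraD(1-3)[OF assms(1)] algebra_derivationD[OF assms(2)] algebra_simps)

lemma algebra_derivation_scale:
  assumes "comm_algebra s" "algebra_derivation s E"
  shows "algebra_derivation s (\<lambda>x. s c (E x))"
  using algebra_derivation_mult[OF assms, of "s c 1"] by (simp add: comm_algebraD(2)[OF assms(1)])

lemma algebra_derivation_uminus:
  assumes "comm_algebra s" "algebra_derivation s E"
  shows "algebra_derivation s (\<lambda>x. - E x)"
  using algebra_derivation_mult[OF assms, of "- 1"] by simp

lemma algebra_derivation_zero:
  assumes "comm_algebra s"
  shows "algebra_derivation s (\<lambda>x. 0)"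
proof -
  interpret vector_space s using comm_algebraD(1)[OF assms] .
  show ?thesis unfolding algebra_derivation_iff using vector_space_axioms by simp
qed

definition biderivation :: "('k::field \<Rightarrow> 's::comm_ring_1 \<Rightarrow> 's) \<Rightarrow> ('s \<Rightarrow> 's \<Rightarrow> 's) \<Rightarrow> bool" where
  "biderivation s P \<longleftrightarrow>
     (\<forall>x. algebra_derivation s (\<lambda>y. P x y)) \<and> (\<forall>y. algebra_derivation s (\<lambda>x. P x y))"

lemma biderivationD:
  assumes "biderivation s P"
  shows "algebra_derivation s (\<lambda>y. P x y)" "algebra_derivation s (\<lambda>x. P x y)"
  using assms by (simp_all add: biderivation_def)

lemma biderivation_simps:
  assumes "biderivation s P"
  shows "P (x + y) z = P x z + P y z" "P x (y + z) = P x y + P x z"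
    "P (s c x) z = s c (P x z)" "P x (s c z) = s c (P x z)"
    "P (x * y) z = P x z * y + x * P y z" "P x (y * z) = P x y * z + y * P x z"
    "P (x - y) z = P x z - P y z" "P x (y - z) = P x y - P x z"
    "P (- x) z = - P x z" "P x (- z) = - P x z" "P 0 z = 0" "P x 0 = 0"
  by (simp_all add: algebra_derivationD[OF biderivationD(1)[OF assms]]
      algebra_derivationD[OF biderivationD(2)[OF assms]])

lemma biderivation_eqI:
  assumes S: "symmetric_algebra sV sS \<iota>"
    and P: "biderivation sS P" and Q: "biderivation sS Q"
    and gen: "\<And>u v. P (\<iota> u) (\<iota> v) = Q (\<iota> u) (\<iota> v)"
  shows "P x y = Q x y"
proof (rule derivation_eqI[OF S biderivationD(2)[OF P] biderivationD(2)[OF Q]])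
  show "P (\<iota> u) y = Q (\<iota> u) y" for u
    by (rule derivation_eqI[OF S biderivationD(1)[OF P] biderivationD(1)[OF Q] gen])
qed

text \<open>
  In \<open>E (P (x * y) z)\<close> the Leibniz rules of \<open>E\<close> and \<open>P\<close> produce the mixed terms \<open>E x * P y z\<close> and
  \<open>P x z * E y\<close>; these are exactly the surplus terms of \<open>P (E (x * y)) z\<close>, so they cancel.
\<close>

lemma biderivation_derived_op:
  assumes "comm_algebra s" "biderivation s P" "algebra_derivation s E"
  shows "biderivation s (derived_op E P)"
proof -
  interpret vector_space s using comm_algebraD(1)[OF assms(1)] .
  show ?thesis
    using vector_space_axioms unfolding biderivation_def algebra_derivation_iff derived_op_def
    by (simp add: biderivation_simps[OF assms(2)] algebra_derivationD[OF assms(3)] algebra_simps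
        comm_algebraD(2,3)[OF assms(1)])
qed

lemma biderivation_combination:
  assumes "comm_algebra s" "biderivation s P" "biderivation s Q"
  shows "biderivation s (\<lambda>x y. s a (P x y) + s b (Q x y))"
  using assms unfolding biderivation_def
  by (intro conjI allI algebra_derivation_sum algebra_derivation_scale) auto

lemma bilinear_op_simps:
  assumes "bilinear_op s \<psi>"
  shows "\<psi> (x + y) z = \<psi> x z + \<psi> y z" "\<psi> x (y + z) = \<psi> x y + \<psi> x z"
    "\<psi> (s c x) z = s c (\<psi> x z)" "\<psi> x (s c z) = s c (\<psi> x z)"
    "\<psi> (x - y) z = \<psi> x z - \<psi> y z" "\<psi> x (y - z) = \<psi> x y - \<psi> x z"
    "\<psi> (- x) z = - \<psi> x z" "\<psi> x (- z) = - \<psi> x z" "\<psi> 0 z = 0" "\<psi> x 0 = 0"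
proof -
  have "Vector_Spaces.linear s s (\<lambda>y. \<psi> x y)" "Vector_Spaces.linear s s (\<lambda>x. \<psi> x y)" for x y
    using assms by (auto simp: bilinear_op_def)
  note this[THEN linearD(3)] this[THEN linearD(4)] this[THEN linearD(5)] this[THEN linearD(6)]
    this[THEN linearD(7)]
  then show "\<psi> (x + y) z = \<psi> x z + \<psi> y z" "\<psi> x (y + z) = \<psi> x y + \<psi> x z"
    "\<psi> (s c x) z = s c (\<psi> x z)" "\<psi> x (s c z) = s c (\<psi> x z)"
    "\<psi> (x - y) z = \<psi> x z - \<psi> y z" "\<psi> x (y - z) = \<psi> x y - \<psi> x z"
    "\<psi> (- x) z = - \<psi> x z" "\<psi> x (- z) = - \<psi> x z" "\<psi> 0 z = 0" "\<psi> x 0 = 0"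
    by simp_all
qed

lemma bilinear_op_vector_space: "bilinear_op s \<psi> \<Longrightarrow> vector_space s"
  by (auto simp: bilinear_op_def Vector_Spaces.linear_iff)

lemma bilinear_opI:
  assumes "vector_space s"
    "\<And>x y z. \<psi> (x + y) z = \<psi> x z + \<psi> y z" "\<And>x y z. \<psi> x (y + z) = \<psi> x y + \<psi> x z"
    "\<And>c x z. \<psi> (s c x) z = s c (\<psi> x z)" "\<And>c x z. \<psi> x (s c z) = s c (\<psi> x z)"
  shows "bilinear_op s \<psi>"
  using assms by (simp add: bilinear_op_def Vector_Spaces.linear_iff)

lemma bilinear_op_derived_op:
  assumes "bilinear_op s \<psi>" "Vector_Spaces.linear s s D"
  shows "bilinear_op s (derived_op D \<psi>)"
proof -
  interpret vector_space s using bilinear_op_vector_space[OF assms(1)] .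
  show ?thesis
    by (rule bilinear_opI)
      (simp_all add: vector_space_axioms derived_op_def bilinear_op_simps[OF assms(1)]
        linearD[OF assms(2)] algebra_simps)
qed

lemma derived_op_skew:
  assumes "\<And>x y. \<psi> x y = - \<psi> y x" "Vector_Spaces.linear s s D"
  shows "derived_op D \<psi> x y = - derived_op D \<psi> y x"
  using assms(1)[of x y] assms(1)[of "D x" y] assms(1)[of x "D y"]
  by (simp add: derived_op_def linearD[OF assms(2)])

section \<open>The mixed Jacobiator\<close>

definition jacobiator :: "('a::ab_group_add \<Rightarrow> 'a \<Rightarrow> 'a) \<Rightarrow> ('a \<Rightarrow> 'a \<Rightarrow> 'a) \<Rightarrow> 'a \<Rightarrow> 'a \<Rightarrow> 'a \<Rightarrow> 'a" where
  "jacobiator \<psi> \<phi> x y z = \<psi> x (\<phi> y z) + \<psi> y (\<phi> z x) + \<psi> z (\<phi> x y)"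

lemma lie_bracket_iff:
  "lie_bracket s \<psi> \<longleftrightarrow>
     bilinear_op s \<psi> \<and> (\<forall>x y. \<psi> x y = - \<psi> y x) \<and> (\<forall>x y z. jacobiator \<psi> \<psi> x y z = 0)"
  by (simp add: lie_bracket_def jacobiator_def)

lemma lie_bracket_derived_op_iff:
  assumes "lie_bracket s \<psi>" "Vector_Spaces.linear s s D"
  shows "lie_bracket s (derived_op D \<psi>) \<longleftrightarrow>
    (\<forall>x y z. jacobiator (derived_op D \<psi>) (derived_op D \<psi>) x y z = 0)"
proof -
  have bil: "bilinear_op s \<psi>" and skew: "\<And>x y. \<psi> x y = - \<psi> y x"
    using assms(1) unfolding lie_bracket_iff by blast+
  have "bilinear_op s (derived_op D \<psi>)" by (rule bilinear_op_derived_op[OF bil assms(2)])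
  moreover have "\<forall>x y. derived_op D \<psi> x y = - derived_op D \<psi> y x"
    by (intro allI) (rule derived_op_skew[OF skew assms(2)])
  ultimately show ?thesis unfolding lie_bracket_iff by blast
qed

text \<open>
  Here \<open>D\<close> acts on trilinear operations in the way \<^const>\<open>derived_op\<close> does on bilinear ones, and the
  Jacobiator obeys the product rule for this action.
\<close>

lemma jacobiator_derivative:
  assumes \<psi>: "bilinear_op s \<psi>" and D: "Vector_Spaces.linear s s D"
  shows "D (jacobiator \<psi> \<phi> x y z) - jacobiator \<psi> \<phi> (D x) y z - jacobiator \<psi> \<phi> x (D y) z
      - jacobiator \<psi> \<phi> x y (D z)
    = jacobiator (derived_op D \<psi>) \<phi> x y z + jacobiator \<psi> (derived_op D \<phi>) x y z"
  by (simp add: jacobiator_def derived_op_def linearD[OF D] bilinear_op_simps[OF \<psi>] algebra_simps)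

lemma jacobiator_combination_left:
  assumes "vector_space s"
  shows "jacobiator (\<lambda>x y. s a (\<psi> x y) + s b (\<phi> x y)) \<chi> x y z
    = s a (jacobiator \<psi> \<chi> x y z) + s b (jacobiator \<phi> \<chi> x y z)"
proof -
  interpret vector_space s by fact
  show ?thesis by (simp add: jacobiator_def algebra_simps)
qed

lemma jacobiator_combination_right:
  assumes "bilinear_op s \<chi>"
  shows "jacobiator \<chi> (\<lambda>x y. s a (\<psi> x y) + s b (\<phi> x y)) x y z
    = s a (jacobiator \<chi> \<psi> x y z) + s b (jacobiator \<chi> \<phi> x y z)"
proof -
  interpret vector_space s using bilinear_op_vector_space[OF assms] .
  show ?thesis by (simp add: jacobiator_def bilinear_op_simps[OF assms] algebra_simps)
qed

text \<open>
  The product rule is used twice: the first derivative of the Jacobi identity kills the mixed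
  Jacobiator, and the second leaves \<open>2 J(\<psi>', \<psi>')\<close> once \<open>\<psi>''\<close> is a combination of \<open>\<psi>\<close> and \<open>\<psi>'\<close>.
  The three vanishing Jacobiators are the coefficients in the expansion of the Jacobi identity for
  \<open>c \<psi> + d \<psi>'\<close>.
\<close>

lemma near_derivation_compatible:
  fixes s :: "'k::field_char_0 \<Rightarrow> 'a::ab_group_add \<Rightarrow> 'a"
  assumes lie: "lie_bracket s \<psi>" and near: "near_derivation s \<psi> D"
  shows "compatible_lie_brackets s \<psi> (derived_op D \<psi>)"
proof -
  let ?\<psi>1 = "derived_op D \<psi>"
  let ?\<psi>2 = "derived_op D ?\<psi>1"
  from near obtain a b where D: "Vector_Spaces.linear s s D"
    and ab: "?\<psi>2 = (\<lambda>x y. s a (\<psi> x y) + s b (?\<psi>1 x y))"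
    unfolding near_derivation_def by metis
  from lie have bil: "bilinear_op s \<psi>" and skew: "\<And>x y. \<psi> x y = - \<psi> y x"
    and jac0: "\<And>x y z. jacobiator \<psi> \<psi> x y z = 0"
    unfolding lie_bracket_iff by blast+
  interpret vector_space s using bilinear_op_vector_space[OF bil] .
  have bil1: "bilinear_op s ?\<psi>1" by (rule bilinear_op_derived_op[OF bil D])
  have skew1: "?\<psi>1 x y = - ?\<psi>1 y x" for x y by (rule derived_op_skew[OF skew D])
  have jac01: "jacobiator ?\<psi>1 \<psi> x y z + jacobiator \<psi> ?\<psi>1 x y z = 0" for x y z
    using jacobiator_derivative[OF bil D, of \<psi> x y z] by (simp add: jac0 linearD[OF D])
  have "jacobiator ?\<psi>2 \<psi> x y z + jacobiator ?\<psi>1 ?\<psi>1 x y z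
      + (jacobiator ?\<psi>1 ?\<psi>1 x y z + jacobiator \<psi> ?\<psi>2 x y z) = 0" for x y z
  proof -
    let ?J = "\<lambda>x y z. jacobiator ?\<psi>1 \<psi> x y z + jacobiator \<psi> ?\<psi>1 x y z"
    have "jacobiator ?\<psi>2 \<psi> x y z + jacobiator ?\<psi>1 ?\<psi>1 x y z
        + (jacobiator ?\<psi>1 ?\<psi>1 x y z + jacobiator \<psi> ?\<psi>2 x y z)
      = D (?J x y z) - ?J (D x) y z - ?J x (D y) z - ?J x y (D z)"
      unfolding jacobiator_derivative[OF bil D, of ?\<psi>1, symmetric]
        jacobiator_derivative[OF bil1 D, of \<psi>, symmetric]
      by (simp add: linearD(3)[OF D])
    then show ?thesis unfolding jac01 by (simp add: linearD(7)[OF D])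
  qed
  then have two: "jacobiator ?\<psi>2 \<psi> x y z + jacobiator \<psi> ?\<psi>2 x y z
      + (jacobiator ?\<psi>1 ?\<psi>1 x y z + jacobiator ?\<psi>1 ?\<psi>1 x y z) = 0" for x y z
    by (simp add: add_ac)
  have jac02: "jacobiator ?\<psi>2 \<psi> x y z + jacobiator \<psi> ?\<psi>2 x y z = 0" for x y z
  proof -
    have "jacobiator ?\<psi>2 \<psi> x y z + jacobiator \<psi> ?\<psi>2 x y z
      = s b (jacobiator ?\<psi>1 \<psi> x y z + jacobiator \<psi> ?\<psi>1 x y z)"
      unfolding ab jacobiator_combination_left[OF vector_space_axioms]
        jacobiator_combination_right[OF bil] jac0
      by (simp add: scale_right_distrib)
    then show ?thesis by (simp add: jac01)
  qed
  have "s 2 (jacobiator ?\<psi>1 ?\<psi>1 x y z) = 0" for x y z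
    using two[of x y z] scale_left_distrib[of 1 1 "jacobiator ?\<psi>1 ?\<psi>1 x y z"]
    by (simp add: jac02)
  then have jac1: "jacobiator ?\<psi>1 ?\<psi>1 x y z = 0" for x y z by simp
  have "lie_bracket s (\<lambda>x y. s c (\<psi> x y) + s d (?\<psi>1 x y))" for c d
    unfolding lie_bracket_iff
  proof (intro conjI allI)
    show bil': "bilinear_op s (\<lambda>x y. s c (\<psi> x y) + s d (?\<psi>1 x y))"
      by (rule bilinear_opI) (simp_all add: vector_space_axioms bilinear_op_simps[OF bil]
          bilinear_op_simps[OF bil1] algebra_simps)
    show "s c (\<psi> x y) + s d (?\<psi>1 x y) = - (s c (\<psi> y x) + s d (?\<psi>1 y x))" for x y
      using skew[of x y] skew1[of x y] by simp
    show "jacobiator (\<lambda>x y. s c (\<psi> x y) + s d (?\<psi>1 x y)) (\<lambda>x y. s c (\<psi> x y) + s d (?\<psi>1 x y)) x y z = 0"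
      for x y z
    proof -
      have "jacobiator \<psi> ?\<psi>1 x y z = - jacobiator ?\<psi>1 \<psi> x y z"
        using jac01[of x y z] by (simp add: eq_neg_iff_add_eq_0 add.commute)
      then show ?thesis
        unfolding jacobiator_combination_left[OF vector_space_axioms]
          jacobiator_combination_right[OF bil] jacobiator_combination_right[OF bil1] jac0 jac1
        by (simp add: mult.commute)
    qed
  qed
  moreover have "lie_bracket s ?\<psi>1" using bil1 skew1 jac1 unfolding lie_bracket_iff by blast
  ultimately show ?thesis using lie by (simp add: compatible_lie_brackets_def)
qed

section \<open>The Lie-Poisson bracket\<close>

text \<open>
  Expanding at a product \<open>a * b\<close> leaves, besides the wanted terms, products of two brackets such as
  \<open>P y a * P z b + P a y * P z b\<close>, which skew-symmetry cancels in pairs.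
\<close>

lemma algebra_derivation_jacobiator:
  assumes A: "comm_algebra s" and P: "biderivation s P" and skew: "\<And>x y. P x y = - P y x"
  shows "algebra_derivation s (\<lambda>x. jacobiator P P x y z)"
proof -
  interpret vector_space s using comm_algebraD(1)[OF A] .
  have leib: "jacobiator P P (a * b) y z = jacobiator P P a y z * b + a * jacobiator P P b y z" for a b
    using skew[of a y] skew[of b y]
    by (simp add: jacobiator_def biderivation_simps[OF P] algebra_simps)
  show ?thesis
    using vector_space_axioms leib unfolding algebra_derivation_iff
    by (simp add: jacobiator_def biderivation_simps[OF P] algebra_simps)
qed

lemma jacobiator_rotate: "jacobiator \<psi> \<phi> x y z = jacobiator \<psi> \<phi> y z x"
  by (simp add: jacobiator_def algebra_simps)

lemma jacobiator_eq_0: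
  assumes S: "symmetric_algebra sV sS \<iota>"
    and P: "biderivation sS P" and skew: "\<And>x y. P x y = - P y x"
    and gen: "\<And>u v w. jacobiator P P (\<iota> u) (\<iota> v) (\<iota> w) = 0"
  shows "jacobiator P P x y z = 0"
proof -
  have A: "comm_algebra sS" using S by (simp add: symmetric_algebra_def)
  \<comment> \<open>The Jacobiator is a derivation in its first argument, and the cyclic symmetry brings each
    argument to that place in turn.\<close>
  have step: "jacobiator P P x y z = 0" if "\<And>u. jacobiator P P (\<iota> u) y z = 0" for x y z
    by (rule derivation_eqI[OF S algebra_derivation_jacobiator[OF A P skew]
          algebra_derivation_zero[OF A] that])
  have one: "jacobiator P P x (\<iota> v) (\<iota> w) = 0" for x v w
    by (rule step) (rule gen)
  have two: "jacobiator P P y (\<iota> w) x = 0" for x y w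
    by (rule step) (simp add: one flip: jacobiator_rotate[of P P x])
  have "jacobiator P P z x y = 0"
    by (rule step) (simp add: two flip: jacobiator_rotate[of P P y])
  then show ?thesis by (simp only: jacobiator_rotate[of P P z x y])
qed

text \<open>
  This form makes the Poisson axioms symmetric in the two arguments, so that the results on
  biderivations apply.
\<close>

lemma poisson_bracket_iff:
  "poisson_bracket s P \<longleftrightarrow>
     biderivation s P \<and> (\<forall>x y. P x y = - P y x) \<and> (\<forall>x y z. jacobiator P P x y z = 0)"
proof
  assume P: "poisson_bracket s P"
  then have bil: "bilinear_op s P" and skew: "\<And>x y. P x y = - P y x"
    and jac: "\<forall>x y z. jacobiator P P x y z = 0"
    and leib: "\<And>x y z. P (x * y) z = x * P y z + P x z * y"
    unfolding poisson_bracket_def lie_bracket_iff by blast+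
  have "P x (y * z) = P x y * z + y * P x z" for x y z
    using skew[of x "y * z"] skew[of y x] skew[of z x] by (simp add: leib)
  then have "biderivation s P"
    using bil leib by (simp add: biderivation_def algebra_derivation_def bilinear_op_def)
  then show "biderivation s P \<and> (\<forall>x y. P x y = - P y x) \<and> (\<forall>x y z. jacobiator P P x y z = 0)"
    using skew jac by blast
next
  assume P: "biderivation s P \<and> (\<forall>x y. P x y = - P y x) \<and> (\<forall>x y z. jacobiator P P x y z = 0)"
  then have bid: "biderivation s P" by blast
  then have "bilinear_op s P"
    unfolding biderivation_def algebra_derivation_def bilinear_op_def by blast
  moreover have "\<forall>x y z. P (x * y) z = x * P y z + P x z * y"
    by (simp add: biderivation_simps[OF bid])
  ultimately show "poisson_bracket s P"
    using P
    unfolding poisson_bracket_def lie_bracket_iff by blast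
qed

text \<open>
  The extension is made one argument at a time: \<open>br u\<close> extends to a derivation \<open>ad u\<close>; for fixed
  \<open>t\<close> the map \<open>u \<mapsto> ad u t\<close> is linear, so it extends to a derivation \<open>E t\<close>. That \<open>E t x\<close> is also
  a derivation in \<open>t\<close> is an equality of derivations in \<open>x\<close>, so it is enough to see it on
  generators, where \<open>E t (\<iota> u)\<close> is \<open>ad u t\<close>.
\<close>

lemma biderivation_extension_exists:
  assumes V: "vector_space sV" and S: "symmetric_algebra sV sS \<iota>"
    and br: "bilinear_op sV br"
  shows "\<exists>P. biderivation sS P \<and> (\<forall>u v. P (\<iota> u) (\<iota> v) = \<iota> (br u v))"
proof -
  have A: "comm_algebra sS" using S by (simp add: symmetric_algebra_def)
  note \<iota> = linearD[OF symmetric_algebra_linear[OF V S]]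
  have "\<exists>E. algebra_derivation sS E \<and> (\<forall>v. E (\<iota> v) = \<iota> (br u v))" for u
    by (intro derivation_extension_exists[OF V S] linearI)
      (simp_all add: \<iota> bilinear_op_simps[OF br])
  then obtain ad where ad: "\<And>u. algebra_derivation sS (ad u)" "\<And>u v. ad u (\<iota> v) = \<iota> (br u v)"
    by metis
  have ad_add: "ad (u + v) t = ad u t + ad v t" for u v t
    by (rule derivation_eqI[OF S])
      (simp_all add: ad algebra_derivation_sum bilinear_op_simps[OF br] \<iota>)
  have ad_scale: "ad (sV c u) t = sS c (ad u t)" for c u t
    by (rule derivation_eqI[OF S])
      (simp_all add: ad algebra_derivation_scale[OF A] bilinear_op_simps[OF br] \<iota>)
  have "\<exists>E. algebra_derivation sS E \<and> (\<forall>u. E (\<iota> u) = ad u t)" for t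
    by (intro derivation_extension_exists[OF V S] linearI)
      (simp_all add: \<iota> ad_add ad_scale)
  then obtain E where E: "\<And>t. algebra_derivation sS (E t)" "\<And>u t. E t (\<iota> u) = ad u t"
    by metis
  have "E (x + y) t = E x t + E y t" for x y t
    by (rule derivation_eqI[OF S])
      (simp_all add: E algebra_derivation_sum algebra_derivationD[OF ad(1)])
  moreover have "E (sS c x) t = sS c (E x t)" for c x t
    by (rule derivation_eqI[OF S])
      (simp_all add: E algebra_derivation_scale[OF A] algebra_derivationD[OF ad(1)])
  moreover have "E (x * y) t = y * E x t + x * E y t" for x y t
    by (rule derivation_eqI[OF S])
      (simp_all add: E algebra_derivation_sum algebra_derivation_mult[OF A]
        algebra_derivationD[OF ad(1)] mult.commute)
  ultimately have "biderivation sS (\<lambda>x y. E y x)"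
    unfolding biderivation_def using E(1) comm_algebraD(1)[OF A]
    by (auto simp: algebra_derivation_iff mult.commute)
  then show ?thesis using E(2) ad(2) by auto
qed

lemma lie_poisson_bracket:
  assumes V: "vector_space sV" and S: "symmetric_algebra sV sS \<iota>"
    and lie: "lie_bracket sV br"
  shows "poisson_bracket sS (lie_poisson sS \<iota> br)"
    and "lie_poisson sS \<iota> br (\<iota> x) (\<iota> y) = \<iota> (br x y)"
proof -
  have A: "comm_algebra sS" using S by (simp add: symmetric_algebra_def)
  note \<iota> = linearD[OF symmetric_algebra_linear[OF V S]]
  have bil: "bilinear_op sV br" and skew: "\<And>x y. br x y = - br y x"
    and jac: "\<And>x y z. jacobiator br br x y z = 0"
    using lie unfolding lie_bracket_iff by blast+
  obtain P where P: "biderivation sS P" and gen: "\<And>u v. P (\<iota> u) (\<iota> v) = \<iota> (br u v)"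
    using biderivation_extension_exists[OF V S bil] by blast
  have flip: "biderivation sS (\<lambda>x y. - P y x)"
    using P unfolding biderivation_def by (auto intro: algebra_derivation_uminus[OF A])
  have P_skew: "P x y = - P y x" for x y
    by (rule biderivation_eqI[OF S P flip]) (metis gen skew \<iota>(6))
  have jac_gen: "jacobiator P P (\<iota> u) (\<iota> v) (\<iota> w) = \<iota> (jacobiator br br u v w)" for u v w
    by (simp add: jacobiator_def gen \<iota>)
  have "jacobiator P P x y z = 0" for x y z
    by (rule jacobiator_eq_0[OF S P P_skew]) (simp add: jac_gen jac \<iota>)
  with P P_skew have "poisson_bracket sS P" unfolding poisson_bracket_iff by blast
  moreover have "Q = P" if "poisson_bracket sS Q \<and> (\<forall>u v. Q (\<iota> u) (\<iota> v) = \<iota> (br u v))" for Q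
  proof (intro ext)
    have "biderivation sS Q" using that unfolding poisson_bracket_iff by blast
    then show "Q x y = P x y" for x y
      by (rule biderivation_eqI[OF S _ P]) (simp add: that gen)
  qed
  ultimately have "\<exists>!P. poisson_bracket sS P \<and> (\<forall>x y. P (\<iota> x) (\<iota> y) = \<iota> (br x y))"
    using gen by blast
  from theI'[OF this, folded lie_poisson_def]
  show "poisson_bracket sS (lie_poisson sS \<iota> br)"
    and "lie_poisson sS \<iota> br (\<iota> x) (\<iota> y) = \<iota> (br x y)" by auto
qed

section \<open>Transfer between the Lie algebra and its symmetric algebra\<close>

theorem lemma4p4:
  fixes scaleq :: "'k::field_char_0 \<Rightarrow> 'q::ab_group_add \<Rightarrow> 'q"
    and B :: "'q set"
    and br :: "'q \<Rightarrow> 'q \<Rightarrow> 'q"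
    and D :: "'q \<Rightarrow> 'q"
    and scaleS :: "'k \<Rightarrow> 's::comm_ring_1 \<Rightarrow> 's"
    and \<iota> :: "'q \<Rightarrow> 's"
  assumes "finite_dimensional_vector_space scaleq B"
    and "lie_bracket scaleq br"
    and "Vector_Spaces.linear scaleq scaleq D"
    and "symmetric_algebra scaleq scaleS \<iota>"
  shows "let P = lie_poisson scaleS \<iota> br; Dhat = leibniz_extension scaleS \<iota> D in
      (lie_bracket scaleq (derived_op D br) \<longleftrightarrow> poisson_bracket scaleS (derived_op Dhat P)) \<and>
      (near_derivation scaleq br D \<longleftrightarrow> near_derivation scaleS P Dhat) \<and>
      (quasi_derivation scaleq br D \<longleftrightarrow> quasi_derivation scaleS P Dhat) \<and>
      (near_derivation scaleq br D \<longrightarrow> compatible_lie_brackets scaleq br (derived_op D br))"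
proof -
  note lie = assms(2) and D = assms(3) and S = assms(4)
  have V: "vector_space scaleq"
    using assms(1) by (rule finite_dimensional_vector_space.axioms(1))
  have A: "comm_algebra scaleS" using S by (simp add: symmetric_algebra_def)
  note \<iota> = linearD[OF symmetric_algebra_linear[OF V S]]
  have inj: "\<iota> v = \<iota> w \<longleftrightarrow> v = w" for v w
    using symmetric_algebra_inj[OF V S, of "v - w"] by (auto simp: \<iota>)
  define P where "P = lie_poisson scaleS \<iota> br"
  define E where "E = leibniz_extension scaleS \<iota> D"
  note E = leibniz_extension_derivation[OF V S D, folded E_def]
  have P: "poisson_bracket scaleS P" "P (\<iota> x) (\<iota> y) = \<iota> (br x y)" for x y
    using lie_poisson_bracket[OF V S lie] by (simp_all add: P_def)
  then have bid: "biderivation scaleS P" and skew: "\<And>x y. P x y = - P y x"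
    unfolding poisson_bracket_iff by blast+
  have lin: "Vector_Spaces.linear scaleS scaleS E" using E(1) by (simp add: algebra_derivation_def)
  let ?P1 = "derived_op E P" and ?br1 = "derived_op D br"
  let ?P2 = "derived_op E ?P1" and ?br2 = "derived_op D ?br1"
  have bid1: "biderivation scaleS ?P1" and bid2: "biderivation scaleS ?P2"
    by (intro biderivation_derived_op A bid E(1))+
  have gen1: "?P1 (\<iota> x) (\<iota> y) = \<iota> (?br1 x y)" for x y
    by (simp add: derived_op_def P(2) E(2) \<iota>)
  have gen2: "?P2 (\<iota> x) (\<iota> y) = \<iota> (?br2 x y)" for x y
    by (subst (1 2) derived_op_def) (simp add: gen1 E(2) \<iota>)
  have skew1: "?P1 x y = - ?P1 y x" for x y by (rule derived_op_skew[OF skew lin])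

  have jac_gen: "jacobiator ?P1 ?P1 (\<iota> x) (\<iota> y) (\<iota> z) = \<iota> (jacobiator ?br1 ?br1 x y z)" for x y z
    by (simp add: jacobiator_def gen1 \<iota>)
  have "lie_bracket scaleq ?br1 \<longleftrightarrow> (\<forall>x y z. jacobiator ?br1 ?br1 x y z = 0)"
    by (rule lie_bracket_derived_op_iff[OF lie D])
  also have "\<dots> \<longleftrightarrow> (\<forall>x y z. jacobiator ?P1 ?P1 (\<iota> x) (\<iota> y) (\<iota> z) = 0)"
    unfolding jac_gen using inj[of _ 0] by (simp add: \<iota>)
  also have "\<dots> \<longleftrightarrow> (\<forall>x y z. jacobiator ?P1 ?P1 x y z = 0)"
  proof
    assume "\<forall>x y z. jacobiator ?P1 ?P1 (\<iota> x) (\<iota> y) (\<iota> z) = 0"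
    then have "jacobiator ?P1 ?P1 x y z = 0" for x y z
      by (intro jacobiator_eq_0[OF S bid1 skew1, of x y z]) simp
    then show "\<forall>x y z. jacobiator ?P1 ?P1 x y z = 0" by blast
  qed simp
  also have "\<dots> \<longleftrightarrow> poisson_bracket scaleS ?P1"
    unfolding poisson_bracket_iff using bid1 skew1 by meson
  finally have part1: "lie_bracket scaleq ?br1 \<longleftrightarrow> poisson_bracket scaleS ?P1" .

  have relation: "(\<forall>x y. ?br2 x y = scaleq a (br x y) + scaleq b (?br1 x y)) \<longleftrightarrow>
      (\<forall>x y. ?P2 x y = scaleS a (P x y) + scaleS b (?P1 x y))" (is "?L \<longleftrightarrow> ?R") for a b
  proof -
    have "?L \<longleftrightarrow> (\<forall>x y. ?P2 (\<iota> x) (\<iota> y) = scaleS a (P (\<iota> x) (\<iota> y)) + scaleS b (?P1 (\<iota> x) (\<iota> y)))"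
      unfolding gen1 gen2 P(2) by (simp add: inj flip: \<iota>(3,4))
    also have "\<dots> \<longleftrightarrow> ?R"
      using biderivation_eqI[OF S bid2 biderivation_combination[OF A bid bid1]] by blast
    finally show ?thesis .
  qed
  have part2: "near_derivation scaleq br D \<longleftrightarrow> near_derivation scaleS P E"
    unfolding near_derivation_def using D lin relation by simp

  interpret q: vector_space scaleq by fact
  interpret s: vector_space scaleS using comm_algebraD(1)[OF A] .
  have part3: "quasi_derivation scaleq br D \<longleftrightarrow> quasi_derivation scaleS P E"
    unfolding quasi_derivation_def using D lin relation[of 0 0] by simp

  show ?thesis
    unfolding Let_def P_def[symmetric] E_def[symmetric]
    by (intro conjI impI part1 part2 part3 near_derivation_compatible[OF lie])
qed

end
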